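(* For any $a\in\mathbb{C}\setminus\{0,1\}$, the pencil of plane cubic curves $P_a=\{\lambda (x-ay)(x^2+y^2-z^2)+\mu (x-y)(x^2-xy+y^2-z^2)=0 \mid [\lambda:\mu]\in\mathbb{CP}^1\}$ over $\mathbb{C}$ has exactly $4$ conic-line curves, whose equations are $$C_1: (x-ay)(x^2+y^2-z^2)=0,$$ $$C_2: (x-y)(x^2-xy+y^2-z^2)=0,$$ $$C_3: y\big((2-a)x^2-xy+(1-a)y^2+(a-1)z^2\big)=0,$$ $$C_4: x\big((1-a)x^2+axy+(1-2a)y^2+(a-1)z^2\big)=0.$$
   Context: Curves are in the complex projective plane $\mathbb{CP}^2$ with homogeneous coordinates $[x:y:z]$. A conic-line curve is a curve each of whose irreducible components is a line or an irreducible conic, i.e. it is defined by a form $\prod_{i=1}^t\alpha_i^{m_i}$ with $\alpha_i$ distinct (pairwise non-proportional) linear or irreducible quadratic forms and $m_i\in\mathbb{Z}_{>0}$. *)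

theory Defs
  imports
    Complex_Main
    "HOL-Library.Poly_Mapping"
    "HOL-Library.Numeral_Type"
    "HOL-Computational_Algebra.Factorial_Ring"
begin

text \<open>
  \<open>\<complex>[x,y,z]\<close> as the monoid algebra of the exponent vectors \<open>3 \<Rightarrow>\<^sub>0 nat\<close>;
  the variables \<open>x, y, z\<close> have the indices \<open>0, 1, 2 :: 3\<close>.
\<close>

type_synonym ternary_poly = "(3 \<Rightarrow>\<^sub>0 nat) \<Rightarrow>\<^sub>0 complex"

definition const :: "complex \<Rightarrow> ternary_poly" where
  "const c = Poly_Mapping.single 0 c"

definition var :: "3 \<Rightarrow> ternary_poly" where
  "var i = Poly_Mapping.single (Poly_Mapping.single i 1) 1"

abbreviation X :: ternary_poly where "X \<equiv> var 0"
abbreviation Y :: ternary_poly where "Y \<equiv> var 1"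
abbreviation Z :: ternary_poly where "Z \<equiv> var 2"

definition form_of_degree :: "nat \<Rightarrow> ternary_poly \<Rightarrow> bool" where
  "form_of_degree d F \<longleftrightarrow>
     F \<noteq> 0 \<and> (\<forall>m \<in> Poly_Mapping.keys F. (\<Sum>i\<in>UNIV. Poly_Mapping.lookup m i) = d)"

definition proportional :: "ternary_poly \<Rightarrow> ternary_poly \<Rightarrow> bool" where
  "proportional F G \<longleftrightarrow> (\<exists>c. c \<noteq> 0 \<and> G = const c * F)"

text \<open>
  Components of a curve carry multiplicities, so the curve \<open>F = 0\<close> in \<open>\<complex>\<P>\<^sup>2\<close> is the
  class of the form \<open>F\<close> up to nonzero scalars rather than a bare set of points.
\<close>

definition curve :: "ternary_poly \<Rightarrow> ternary_poly set" where
  "curve F = {G. proportional F G}"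

definition pencil :: "ternary_poly \<Rightarrow> ternary_poly \<Rightarrow> ternary_poly set set" where
  "pencil F G = {curve (const l * F + const m * G) | l m. (l, m) \<noteq> (0, 0)}"

definition conic_line_curve :: "ternary_poly set \<Rightarrow> bool" where
  "conic_line_curve C \<longleftrightarrow>
     (\<exists>(t::nat) (\<alpha> :: nat \<Rightarrow> ternary_poly) (m :: nat \<Rightarrow> nat).
        t \<ge> 1 \<and>
        (\<forall>i\<in>{1..t}. form_of_degree 1 (\<alpha> i) \<or>
                     (form_of_degree 2 (\<alpha> i) \<and> irreducible (\<alpha> i))) \<and>
        (\<forall>i\<in>{1..t}. \<forall>j\<in>{1..t}. i \<noteq> j \<longrightarrow> \<not> proportional (\<alpha> i) (\<alpha> j)) \<and>
        (\<forall>i\<in>{1..t}. m i > 0) \<and>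
        C = curve (\<Prod>i=1..t. \<alpha> i ^ m i))"

end

theory Submission
  imports Defs "HOL-Computational_Algebra.Polynomial"
begin

text \<open>
  Write \<open>F = l C\<^sub>1 + m C\<^sub>2\<close>. A conic-line cubic must contain a line, because a product of
  conics has even degree (\<open>conic_line_curve_odd_has_line\<close>). Conversely, a line times any form of
  degree 2 is a conic-line curve, since a reducible conic splits into two lines
  (\<open>conic_line_curve_line_conic\<close>). So the theorem asks which members contain a line.

  The variable \<open>z\<close> occurs in \<open>F\<close> only through \<open>z\<^sup>2\<close>: \<open>F = f\<^sub>3(x, y) - z\<^sup>2 f\<^sub>1(x, y)\<close> with
  \<open>f\<^sub>1 = l (x - a y) + m (x - y)\<close> and
  \<open>f\<^sub>3 = l (x - a y) (x\<^sup>2 + y\<^sup>2) + m (x - y) (x\<^sup>2 - x y + y\<^sup>2)\<close>. A line in \<open>F = 0\<close> forces a common zero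
  \<open>(x, y) \<noteq> (0, 0)\<close> of \<open>f\<^sub>1\<close> and \<open>f\<^sub>3\<close>. As the two quadratic factors differ by \<open>x y\<close>, one has
  \<open>f\<^sub>3 = (x\<^sup>2 - x y + y\<^sup>2) f\<^sub>1 + l (x - a y) x y\<close>. Hence at a common zero \<open>l (x - a y) x y = 0\<close>; together
  with \<open>f\<^sub>1 = 0\<close> this leaves only \<open>l = 0\<close>, \<open>m = 0\<close>, \<open>l + m = 0\<close> or \<open>a l + m = 0\<close>
  (\<open>line_in_pencil_member\<close>). These four parameters are distinct points of \<open>\<complex>\<P>\<^sup>1\<close> because
  \<open>a \<noteq> 0, 1\<close>, and \<open>C\<^sub>3 = C\<^sub>1 - C\<^sub>2\<close> and \<open>C\<^sub>4 = C\<^sub>1 - a C\<^sub>2\<close> are the members for the last two.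

  Polynomials are handled through two ring homomorphisms out of \<open>\<complex>[x,y,z]\<close>: evaluation at a point, and
  the homogenisation \<open>F(x, y, z) \<mapsto> F(T x, T y, T z)\<close> with values in \<open>\<complex>[x,y,z][T]\<close>. A nonzero \<open>F\<close> is a
  form of degree \<open>d\<close> exactly if the latter is \<open>F T\<^sup>d\<close> (\<open>form_of_degree_iff\<close>), which reduces statements
  about forms to statements about univariate monomials.
\<close>

section \<open>Homomorphisms out of a monoid algebra\<close>

text \<open>
  If \<open>h\<close> is a ring homomorphism and \<open>g\<close> a homomorphism into the multiplicative monoid, this is the
  ring homomorphism induced by \<open>h\<close> on coefficients and by \<open>g\<close> on monomials. Evaluation at a point and
  homogenisation are both of this kind, so the laws are proved once for all such maps.
\<close>

definition extend :: "('b \<Rightarrow> 'c) \<Rightarrow> ('a \<Rightarrow> 'c) \<Rightarrow> ('a \<Rightarrow>\<^sub>0 'b::zero) \<Rightarrow> 'c::comm_ring_1" where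
  "extend h g F = (\<Sum>m\<in>Poly_Mapping.keys F. h (Poly_Mapping.lookup F m) * g m)"

lemma sum_of_monomials:
  fixes F :: "'a \<Rightarrow>\<^sub>0 'b::comm_monoid_add"
  shows "F = (\<Sum>m\<in>Poly_Mapping.keys F. Poly_Mapping.single m (Poly_Mapping.lookup F m))"
  by (rule poly_mapping_eqI)
    (auto simp: lookup_sum lookup_single when_def in_keys_iff)

locale monoid_algebra_hom =
  fixes h :: "'b::comm_ring_1 \<Rightarrow> 'c::comm_ring_1" and g :: "'a::comm_monoid_add \<Rightarrow> 'c"
  assumes h_1: "h 1 = 1" and h_add: "h (c + d) = h c + h d" and h_mult: "h (c * d) = h c * h d"
    and g_0: "g 0 = 1" and g_add: "g (m + n) = g m * g n"
begin

lemma h_0: "h 0 = 0"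
  using h_add[of 0 0] by simp

lemma map_zero: "extend h g 0 = 0"
  by (simp add: extend_def)

lemma map_single: "extend h g (Poly_Mapping.single m c) = h c * g m"
  by (simp add: extend_def h_0)

lemma map_one: "extend h g 1 = 1"
  using map_single[of 0 1] by (simp add: h_1 g_0)

lemma map_add: "extend h g (F + G) = extend h g F + extend h g G"
  unfolding extend_def
  by (rule setsum_keys_plus_distrib) (simp_all add: h_0 h_add algebra_simps)

lemma map_diff: "extend h g (F - G) = extend h g F - extend h g G"
  using map_add[of "F - G" G] by simp

lemma map_sum: "extend h g (sum f A) = (\<Sum>i\<in>A. extend h g (f i))"
  by (induction A rule: infinite_finite_induct) (simp_all add: map_zero map_add)

lemma map_mult: "extend h g (F * G) = extend h g F * extend h g G"
proof -
  have "F * G = (\<Sum>m\<in>Poly_Mapping.keys F. \<Sum>n\<in>Poly_Mapping.keys G.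
      Poly_Mapping.single (m + n) (Poly_Mapping.lookup F m * Poly_Mapping.lookup G n))"
    by (subst sum_of_monomials[of F], subst sum_of_monomials[of G])
      (simp add: sum_product mult_single)
  then have "extend h g (F * G) =
      (\<Sum>m\<in>Poly_Mapping.keys F. \<Sum>n\<in>Poly_Mapping.keys G.
        (h (Poly_Mapping.lookup F m) * g m) * (h (Poly_Mapping.lookup G n) * g n))"
    by (simp add: map_sum map_single h_mult g_add algebra_simps)
  also have "\<dots> = extend h g F * extend h g G"
    by (simp add: extend_def sum_product)
  finally show ?thesis .
qed

lemma map_power: "extend h g (F ^ n) = extend h g F ^ n"
  by (induction n) (simp_all add: map_one map_mult)

lemmas map_simps = map_zero map_one map_add map_diff map_mult map_power

end

section \<open>Constant polynomials\<close>

lemma const_simps [simp]: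
  "const 0 = 0" "const 1 = 1" "const (c + d) = const c + const d" "const (c - d) = const c - const d"
  "const (c * d) = const c * const d" "const (- c) = - const c" "const (numeral w) = numeral w"
  by (simp_all add: const_def single_add single_diff mult_single single_uminus)

lemma const_eq_0_iff [simp]: "const c = 0 \<longleftrightarrow> c = 0"
  by (metis const_def lookup_single_eq lookup_zero single_zero)

section \<open>Evaluation\<close>

definition eval :: "complex \<Rightarrow> complex \<Rightarrow> complex \<Rightarrow> ternary_poly \<Rightarrow> complex" where
  "eval x y z = extend (\<lambda>c. c) (\<lambda>m. x ^ Poly_Mapping.lookup m 0 *
     y ^ Poly_Mapping.lookup m 1 * z ^ Poly_Mapping.lookup m 2)"

interpretation eval: monoid_algebra_hom "\<lambda>c. c" "\<lambda>m. x ^ Poly_Mapping.lookup m 0 *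
     y ^ Poly_Mapping.lookup m 1 * z ^ Poly_Mapping.lookup m (2 :: 3)"
  rewrites "extend (\<lambda>c. c) (\<lambda>m. x ^ Poly_Mapping.lookup m 0 *
     y ^ Poly_Mapping.lookup m 1 * z ^ Poly_Mapping.lookup m 2) = eval x y z" for x y z :: complex
  by unfold_locales (simp_all add: eval_def lookup_add power_add algebra_simps)

lemma eval_generators:
  "eval x y z (const c) = c" "eval x y z X = x" "eval x y z Y = y" "eval x y z Z = z"
  by (simp_all add: const_def var_def eval.map_single lookup_single when_def)

lemmas eval_simps = eval.map_simps eval_generators

section \<open>Homogeneity by way of homogenisation\<close>

abbreviation total_degree :: "(3 \<Rightarrow>\<^sub>0 nat) \<Rightarrow> nat" where
  "total_degree m \<equiv> \<Sum>i\<in>UNIV. Poly_Mapping.lookup m i"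

text \<open>
  The map \<open>F(x, y, z) \<mapsto> F(T x, T y, T z)\<close>; the coefficient of \<open>T\<^sup>d\<close> is the homogeneous part of degree \<open>d\<close>.
\<close>

definition grade :: "ternary_poly \<Rightarrow> ternary_poly poly" where
  "grade = extend (\<lambda>c. [:const c:]) (\<lambda>m. monom (Poly_Mapping.single m 1) (total_degree m))"

interpretation grade: monoid_algebra_hom "\<lambda>c. [:const c:]"
  "\<lambda>m. monom (Poly_Mapping.single m 1) (total_degree m)"
  rewrites "extend (\<lambda>c. [:const c:]) (\<lambda>m. monom (Poly_Mapping.single m 1) (total_degree m)) = grade"
  by unfold_locales
    (simp_all add: grade_def lookup_add sum.distrib mult_monom mult_single monom_0)

lemma grade_single: "grade (Poly_Mapping.single m c) = monom (Poly_Mapping.single m c) (total_degree m)"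
  by (simp add: grade.map_single const_def mult_single smult_monom)

lemma grade_generators: "grade (const c) = monom (const c) 0" "grade (var i) = monom (var i) 1"
  by (simp_all add: const_def var_def grade_single lookup_single when_def)

lemmas grade_simps = grade.map_simps grade_generators

lemma grade_eq: "grade F = (\<Sum>m\<in>Poly_Mapping.keys F.
    monom (Poly_Mapping.single m (Poly_Mapping.lookup F m)) (total_degree m))"
  by (subst sum_of_monomials[of F]) (simp only: grade.map_sum grade_single)

lemma lookup_coeff_grade:
  "Poly_Mapping.lookup (coeff (grade F) d) m = (if total_degree m = d then Poly_Mapping.lookup F m else 0)"
proof -
  have "Poly_Mapping.lookup (coeff (grade F) d) m =
      (\<Sum>n\<in>Poly_Mapping.keys F. if n = m then (if total_degree m = d then Poly_Mapping.lookup F m else 0) else 0)"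
    unfolding grade_eq coeff_sum lookup_sum
    by (intro sum.cong) (auto simp: coeff_monom lookup_single)
  then show ?thesis
    by (auto simp: in_keys_iff)
qed

lemma form_of_degree_iff: "form_of_degree d F \<longleftrightarrow> F \<noteq> 0 \<and> grade F = monom F d"
proof (cases "F = 0")
  case False
  have "(\<forall>m\<in>Poly_Mapping.keys F. total_degree m = d) \<longleftrightarrow> grade F = monom F d"
  proof
    assume "\<forall>m\<in>Poly_Mapping.keys F. total_degree m = d"
    then show "grade F = monom F d"
      by (intro poly_eqI poly_mapping_eqI) (auto simp: lookup_coeff_grade in_keys_iff)
  next
    assume *: "grade F = monom F d"
    show "\<forall>m\<in>Poly_Mapping.keys F. total_degree m = d"
    proof
      fix m assume "m \<in> Poly_Mapping.keys F"
      moreover have "Poly_Mapping.lookup F m = Poly_Mapping.lookup (coeff (grade F) (total_degree m)) m"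
        by (simp add: lookup_coeff_grade)
      ultimately show "total_degree m = d"
        by (auto simp: * in_keys_iff split: if_splits)
    qed
  qed
  then show ?thesis using False by (simp add: form_of_degree_def)
qed (simp add: form_of_degree_def)

lemma form_of_degreeI:
  assumes "grade F = monom F d" "eval x y z F \<noteq> 0"
  shows "form_of_degree d F"
  using assms by (auto simp: form_of_degree_iff eval.map_zero)

text \<open>
  Setting \<open>T = 1\<close> undoes the homogenisation.
\<close>

lemma poly_grade_1: "poly (grade F) 1 = F"
  by (simp add: grade_eq poly_sum poly_monom sum_of_monomials[symmetric])

lemma form_of_degree_unique: "form_of_degree d F \<Longrightarrow> form_of_degree e F \<Longrightarrow> d = e"
  by (metis form_of_degree_iff degree_monom_eq)

lemma form_of_degree_const: "c \<noteq> 0 \<Longrightarrow> form_of_degree 0 (const c)"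
  by (simp add: form_of_degree_iff grade_generators)

lemma form_of_degree_mult:
  "form_of_degree d F \<Longrightarrow> form_of_degree e G \<Longrightarrow> form_of_degree (d + e) (F * G)"
  by (simp add: form_of_degree_iff grade.map_mult mult_monom)

lemma form_of_degree_power: "form_of_degree d F \<Longrightarrow> form_of_degree (n * d) (F ^ n)"
  by (auto simp: form_of_degree_iff grade.map_power monom_power mult.commute)

lemma form_of_degree_prod:
  "(\<And>i. i \<in> A \<Longrightarrow> form_of_degree (d i) (f i)) \<Longrightarrow> form_of_degree (sum d A) (prod f A)"
  by (induction A rule: infinite_finite_induct)
    (use form_of_degree_const[of 1] in \<open>auto intro: form_of_degree_mult\<close>)

text \<open>
  Factors of a form are forms: the product of the homogenisations is a monomial in \<open>T\<close>. Degree and order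
  of vanishing at \<open>T = 0\<close> are both additive and agree for the product. Since the order never exceeds the
  degree, they agree for each factor, which is therefore a monomial in \<open>T\<close> as well.
\<close>

lemma form_of_degree_factors:
  assumes "form_of_degree n (A * B)"
  obtains d e where "d + e = n" "form_of_degree d A" "form_of_degree e B"
proof -
  have AB: "A * B \<noteq> 0" and eq: "grade A * grade B = monom (A * B) n"
    using assms by (simp_all add: form_of_degree_iff grade.map_mult)
  have nz: "grade A * grade B \<noteq> 0"
    using AB by (simp only: eq monom_eq_0_iff) simp
  have "degree (grade A) + degree (grade B) = n"
    using nz by (metis AB eq degree_monom_eq degree_mult_eq mult_eq_0_iff)
  moreover have "order 0 (grade A) + order 0 (grade B) = n"
    using nz AB by (metis eq order_mult order_0_monom)
  moreover have "order 0 (grade A) \<le> degree (grade A)" "order 0 (grade B) \<le> degree (grade B)"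
    using nz by (auto intro: order_degree)
  ultimately have ord: "order 0 (grade A) = degree (grade A)" "order 0 (grade B) = degree (grade B)"
    and sum: "degree (grade A) + degree (grade B) = n"
    by linarith+
  have form: "form_of_degree (degree (grade F)) F"
    if "order 0 (grade F) = degree (grade F)" "F \<noteq> 0" for F
  proof -
    have "grade F \<noteq> 0"
      using poly_grade_1[of F] that by auto
    then obtain q where "grade F = [:- 0, 1:] ^ order 0 (grade F) * q"
      using order_decomp by blast
    note q = this[unfolded that(1) minus_zero]
    have "degree (grade F) = degree ([:0, 1:] ^ degree (grade F) :: ternary_poly poly) + degree q"
      using q \<open>grade F \<noteq> 0\<close> by (metis degree_mult_eq mult_eq_0_iff)
    then have "degree q = 0"
      by (simp add: degree_power_eq)
    then obtain c where "q = [:c:]"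
      by (auto elim: degree_eq_zeroE)
    then have *: "grade F = monom c (degree (grade F))"
      using q by (simp add: monom_altdef)
    then have "F = c"
      using poly_grade_1[of F] by (metis poly_monom power_one mult_1_right)
    then show ?thesis
      using * that(2) by (simp add: form_of_degree_iff)
  qed
  show ?thesis
    using that[OF sum] form ord AB by auto
qed

lemma form_of_degree_0_unit:
  assumes "form_of_degree 0 F"
  shows "F dvd 1"
proof -
  have "m = 0" if "m \<in> Poly_Mapping.keys F" for m
    using assms that by (auto simp: form_of_degree_def intro!: poly_mapping_eqI)
  then have F: "F = const (Poly_Mapping.lookup F 0)"
    by (intro poly_mapping_eqI) (auto simp: const_def lookup_single when_def in_keys_iff)
  moreover have "Poly_Mapping.lookup F 0 \<noteq> 0"
    using assms F by (metis const_simps(1) form_of_degree_def)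
  ultimately have "F * const (1 / Poly_Mapping.lookup F 0) = 1"
    by (metis const_simps(2,5) nonzero_eq_divide_eq mult.commute)
  then show ?thesis
    by (metis dvd_triv_left)
qed

text \<open>
  The factors in a proper factorisation are forms whose degrees add up to 2, and neither degree is 0
  because forms of degree 0 are units.
\<close>

lemma reducible_conic:
  assumes "form_of_degree 2 Q" "\<not> irreducible Q"
  obtains L M where "form_of_degree 1 L" "form_of_degree 1 M" "Q = L * M"
proof -
  have "\<not> Q dvd 1"
  proof
    assume "Q dvd 1"
    then obtain B where "Q * B = 1"
      by (auto simp: dvd_def)
    then have "form_of_degree 0 (Q * B)"
      using form_of_degree_const[of 1] by simp
    then show False
      using assms(1) by (elim form_of_degree_factors) (auto dest: form_of_degree_unique)
  qed
  moreover have "Q \<noteq> 0"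
    using assms(1) by (simp add: form_of_degree_def)
  ultimately obtain A B where AB: "Q = A * B" "\<not> A dvd 1" "\<not> B dvd 1"
    using assms(2) by (auto simp: irreducible_def)
  then obtain d e where de: "d + e = 2" "form_of_degree d A" "form_of_degree e B"
    using assms(1) form_of_degree_factors by metis
  have "d \<noteq> 0" "e \<noteq> 0"
    using AB(2,3) de(2,3) form_of_degree_0_unit[of A] form_of_degree_0_unit[of B] by metis+
  with de(1) have "d = 1" "e = 1"
    by linarith+
  then show ?thesis
    using that de AB(1) by simp
qed

lemma UNIV_3: "UNIV = {0, 1, 2 :: 3}"
  by (rule card_subset_eq[symmetric]) simp_all

lemma linear_form:
  assumes "form_of_degree 1 L"
  obtains p q r where "L = const p * X + const q * Y + const r * Z" "(p, q, r) \<noteq> (0, 0, 0)"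
proof -
  let ?e = "\<lambda>i::3. Poly_Mapping.single i (1::nat)"
  have e: "?e i = ?e j \<longleftrightarrow> i = j" for i j
    by (metis lookup_single_eq lookup_single_not_eq zero_neq_one)
  have keys: "m \<in> {?e 0, ?e 1, ?e 2}" if "m \<in> Poly_Mapping.keys L" for m
  proof -
    have "total_degree m = 1"
      using assms that by (simp add: form_of_degree_def)
    then obtain i where i: "Poly_Mapping.lookup m i = 1" "\<And>j. j \<noteq> i \<Longrightarrow> Poly_Mapping.lookup m j = 0"
      by (subst (asm) sum_eq_1_iff) auto
    then have "m = ?e i"
      by (intro poly_mapping_eqI) (auto simp: lookup_single when_def)
    moreover have "i \<in> {0, 1, 2}"
      using UNIV_3 by auto
    ultimately show ?thesis by auto
  qed
  define p q r where pqr: "p = Poly_Mapping.lookup L (?e 0)" "q = Poly_Mapping.lookup L (?e 1)"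
    "r = Poly_Mapping.lookup L (?e 2)"
  have L: "L = const p * X + const q * Y + const r * Z"
  proof (rule poly_mapping_eqI)
    fix m
    show "Poly_Mapping.lookup L m = Poly_Mapping.lookup (const p * X + const q * Y + const r * Z) m"
      using keys[of m]
      by (cases "m \<in> {?e 0, ?e 1, ?e 2}")
        (auto simp: const_def var_def mult_single lookup_add lookup_single e[unfolded One_nat_def]
          pqr simp flip: not_in_keys_iff_lookup_eq_zero)
  qed
  moreover have "(p, q, r) \<noteq> (0, 0, 0)"
    using assms L by (auto simp: form_of_degree_def)
  ultimately show ?thesis
    using that by blast
qed

section \<open>Conic-line curves\<close>

lemma curve_eq_iff: "curve F = curve G \<longleftrightarrow> proportional F G"
proof
  have "G \<in> curve G"
    by (auto simp: curve_def proportional_def intro!: exI[of _ 1])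
  then show "curve F = curve G \<Longrightarrow> proportional F G"
    by (auto simp: curve_def)
next
  assume "proportional F G"
  then obtain c where c: "c \<noteq> 0" "G = const c * F"
    by (auto simp: proportional_def)
  have "const d * F = const (d / c) * G" "const d * G = const (d * c) * F" for d
    using c by (simp_all only: c(2) mult.assoc[symmetric] const_simps(5)[symmetric]) simp
  then show "curve F = curve G"
    unfolding curve_def proportional_def
    by (smt (verit, best) Collect_cong c(1) divide_eq_0_iff mult_eq_0_iff)
qed

lemma curve_scale: "c \<noteq> 0 \<Longrightarrow> curve (const c * F) = curve F"
  by (metis curve_eq_iff proportional_def)

lemma curve_eqE:
  assumes "curve F = curve G"
  obtains c where "c \<noteq> 0" "F = const c * G"
  using assms[symmetric] by (auto simp: curve_eq_iff proportional_def)

definition component :: "ternary_poly \<Rightarrow> bool" where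
  "component F \<longleftrightarrow> form_of_degree 1 F \<or> form_of_degree 2 F \<and> irreducible F"

lemma conic_line_curve_component:
  assumes "component F"
  shows "conic_line_curve (curve F)"
  unfolding conic_line_curve_def
  by (rule exI[of _ 1], rule exI[of _ "\<lambda>_. F"], rule exI[of _ "\<lambda>_. 1"])
    (use assms in \<open>auto simp: component_def\<close>)

text \<open>
  The components of a conic-line curve have to be pairwise non-proportional. So a new factor that is
  proportional to a component already present has to be absorbed by raising the multiplicity of that
  component.
\<close>

lemma conic_line_curve_mult:
  assumes "component L" "conic_line_curve (curve F)"
  shows "conic_line_curve (curve (L * F))"
proof -
  obtain t :: nat and \<alpha> :: "nat \<Rightarrow> ternary_poly" and m :: "nat \<Rightarrow> nat" where t: "t \<ge> 1" "\<And>i. i \<in> {1..t} \<Longrightarrow> component (\<alpha> i)"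
      "\<And>i j. i \<in> {1..t} \<Longrightarrow> j \<in> {1..t} \<Longrightarrow> i \<noteq> j \<Longrightarrow> \<not> proportional (\<alpha> i) (\<alpha> j)"
      "\<And>i. i \<in> {1..t} \<Longrightarrow> m i > 0" "curve F = curve (\<Prod>i=1..t. \<alpha> i ^ m i)"
    using assms(2) unfolding conic_line_curve_def component_def[symmetric] by blast
  define P where "P = (\<Prod>i=1..t. \<alpha> i ^ m i)"
  obtain c where c: "c \<noteq> 0" "F = const c * P"
    using t(5) unfolding P_def by (rule curve_eqE)
  have LF: "curve (L * F) = curve (L * P)"
    using curve_scale[OF c(1), of "L * P"] by (simp add: c(2) mult.left_commute)
  show ?thesis
  proof (cases "\<exists>k\<in>{1..t}. proportional (\<alpha> k) L")
    case True
    then obtain k d where k: "k \<in> {1..t}" "d \<noteq> 0" "L = const d * \<alpha> k"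
      by (auto simp: proportional_def)
    define m' where "m' = m(k := Suc (m k))"
    have "(\<Prod>i=1..t. \<alpha> i ^ m' i) = \<alpha> k ^ m' k * (\<Prod>i\<in>{1..t} - {k}. \<alpha> i ^ m' i)"
      using k by (simp add: prod.remove)
    also have "(\<Prod>i\<in>{1..t} - {k}. \<alpha> i ^ m' i) = (\<Prod>i\<in>{1..t} - {k}. \<alpha> i ^ m i)"
      by (rule prod.cong) (auto simp: m'_def)
    also have "\<alpha> k ^ m' k * \<dots> = \<alpha> k * P"
      using k by (simp add: P_def m'_def prod.remove mult.assoc)
    finally have "curve (L * P) = curve (\<Prod>i=1..t. \<alpha> i ^ m' i)"
      using curve_scale[OF k(2), of "\<alpha> k * P"] by (simp add: k(3) mult.assoc)
    then show ?thesis
      unfolding conic_line_curve_def component_def[symmetric]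
      by (intro exI[of _ t] exI[of _ \<alpha>] exI[of _ m'])
        (use t LF in \<open>auto simp: m'_def\<close>)
  next
    case False
    define \<alpha>' where "\<alpha>' = \<alpha>(Suc t := L)"
    define m' where "m' = m(Suc t := 1)"
    have "(\<Prod>i=1..t. \<alpha>' i ^ m' i) = P"
      unfolding P_def by (rule prod.cong) (auto simp: \<alpha>'_def m'_def)
    then have "(\<Prod>i=1..Suc t. \<alpha>' i ^ m' i) = L * P"
      by (simp add: \<alpha>'_def m'_def mult.commute)
    moreover have "\<not> proportional (\<alpha>' i) (\<alpha>' j)"
      if "i \<in> {1..Suc t}" "j \<in> {1..Suc t}" "i \<noteq> j" for i j
      using False t(3)[of i j] that
      by (auto simp: \<alpha>'_def curve_eq_iff[symmetric] le_Suc_eq)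
    moreover have "component (\<alpha>' i)" if "i \<in> {1..Suc t}" for i
      using t(2)[of i] assms(1) that by (auto simp: \<alpha>'_def le_Suc_eq)
    moreover have "m' i > 0" if "i \<in> {1..Suc t}" for i
      using t(4)[of i] that by (auto simp: m'_def le_Suc_eq)
    ultimately show ?thesis
      unfolding conic_line_curve_def component_def[symmetric] LF
      by (intro exI[of _ "Suc t"] exI[of _ \<alpha>'] exI[of _ m']) auto
  qed
qed

lemma conic_line_curve_line_conic:
  assumes "form_of_degree 1 L" "form_of_degree 2 Q"
  shows "conic_line_curve (curve (L * Q))"
proof (rule conic_line_curve_mult)
  show "component L"
    using assms(1) by (simp add: component_def)
  show "conic_line_curve (curve Q)"
  proof (cases "irreducible Q")
    case True
    then show ?thesis
      using assms(2) by (intro conic_line_curve_component) (simp add: component_def)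
  next
    case False
    with assms(2) obtain M N where "form_of_degree 1 M" "form_of_degree 1 N" "Q = M * N"
      by (rule reducible_conic)
    then show ?thesis
      by (simp add: conic_line_curve_mult conic_line_curve_component component_def)
  qed
qed

text \<open>
  Without a linear factor the curve would be a product of quadratic forms, hence of even degree.
\<close>

lemma conic_line_curve_odd_has_line:
  assumes "conic_line_curve (curve F)" "form_of_degree d F" "odd d"
  obtains L where "form_of_degree 1 L" "L dvd F"
proof -
  obtain t :: nat and \<alpha> :: "nat \<Rightarrow> ternary_poly" and m :: "nat \<Rightarrow> nat" where t: "\<And>i. i \<in> {1..t} \<Longrightarrow> form_of_degree 1 (\<alpha> i) \<or> form_of_degree 2 (\<alpha> i)"
      "\<And>i. i \<in> {1..t} \<Longrightarrow> m i > 0" "curve F = curve (\<Prod>i=1..t. \<alpha> i ^ m i)"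
    using assms(1) unfolding conic_line_curve_def by blast
  obtain c where c: "c \<noteq> 0" "F = const c * (\<Prod>i=1..t. \<alpha> i ^ m i)"
    using t(3) by (rule curve_eqE)
  have "\<exists>k\<in>{1..t}. form_of_degree 1 (\<alpha> k)"
  proof (rule ccontr)
    assume "\<not> ?thesis"
    then have "form_of_degree (\<Sum>i=1..t. m i * 2) (\<Prod>i=1..t. \<alpha> i ^ m i)"
      using t(1) by (intro form_of_degree_prod form_of_degree_power) auto
    from form_of_degree_mult[OF form_of_degree_const[OF c(1)] this]
    have "d = (\<Sum>i=1..t. m i * 2)"
      using form_of_degree_unique assms(2) c(2) by auto
    then show False
      using assms(3) by (simp add: sum_distrib_right[symmetric])
  qed
  then obtain k where k: "k \<in> {1..t}" "form_of_degree 1 (\<alpha> k)"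
    by blast
  have "\<alpha> k dvd \<alpha> k ^ m k"
    using t(2)[OF k(1)] by (simp add: dvd_power)
  also have "\<dots> dvd (\<Prod>i=1..t. \<alpha> i ^ m i)"
    using k(1) by (intro dvd_prodI) auto
  also have "\<dots> dvd F"
    by (simp add: c(2))
  finally show ?thesis
    using that k(2) by blast
qed


section \<open>Lines in the members of the pencil\<close>

text \<open>
  Let \<open>p x + q y + r z = 0\<close> be the line. If \<open>r = 0\<close>, then all points \<open>(q, - p, z)\<close> lie on it, so both
  \<open>z\<close>-coefficients \<open>f\<^sub>1\<close> and \<open>f\<^sub>3\<close> of \<open>F = f\<^sub>3 - z\<^sup>2 f\<^sub>1\<close> vanish at \<open>(q, - p)\<close>. If \<open>r \<noteq> 0\<close>, then the line
  contains a point above every \<open>(x, y)\<close>, in particular above the zero \<open>(a l + m, l + m)\<close> of \<open>f\<^sub>1\<close>, and there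
  \<open>F = 0\<close> gives \<open>f\<^sub>3 = 0\<close>. Either way there is a common zero of \<open>f\<^sub>1\<close> and \<open>f\<^sub>3\<close>, from which the condition on
  \<open>l\<close> and \<open>m\<close> is read off.
\<close>

lemma line_in_pencil_member:
  fixes a l m :: complex
  defines "F \<equiv> const l * ((X - const a * Y) * (X^2 + Y^2 - Z^2)) +
                const m * ((X - Y) * (X^2 - X * Y + Y^2 - Z^2))"
  assumes "a \<noteq> 1" "(l, m) \<noteq> (0, 0)" "form_of_degree 1 L" "L dvd F"
  shows "l = 0 \<or> m = 0 \<or> l + m = 0 \<or> a * l + m = 0"
proof -
  obtain p q r where L: "L = const p * X + const q * Y + const r * Z" and pqr: "(p, q, r) \<noteq> (0, 0, 0)"
    using assms(4) by (rule linear_form)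
  have vanish: "l * ((x - a * y) * (x^2 + y^2 - z^2)) + m * ((x - y) * (x^2 - x * y + y^2 - z^2)) = 0"
    if "p * x + q * y + r * z = 0" for x y z
  proof -
    have "eval x y z F = 0"
      using \<open>L dvd F\<close> that by (auto simp: dvd_def L eval_simps)
    then show ?thesis
      by (simp add: F_def eval_simps)
  qed
  have "\<exists>x y. (x, y) \<noteq> (0, 0) \<and> l * (x - a * y) + m * (x - y) = 0 \<and>
      l * (x - a * y) * (x^2 + y^2) + m * (x - y) * (x^2 - x * y + y^2) = 0"
  proof (cases "r = 0")
    case True
    have z: "l * ((q + a * p) * (q^2 + p^2 - z^2)) + m * ((q + p) * (q^2 + q * p + p^2 - z^2)) = 0" for z
      using vanish[of q "-p" z] True by simp
    have "l * (q - a * - p) + m * (q - - p) = 0"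
      using arg_cong2[where f = minus, OF z[of 0] z[of 1]] by (simp add: algebra_simps)
    moreover have "l * (q - a * - p) * (q^2 + (- p)^2) + m * (q - - p) * (q^2 - q * - p + (- p)^2) = 0"
      using z[of 0] by (simp add: mult.assoc)
    moreover have "(q, - p) \<noteq> (0, 0)"
      using pqr True by auto
    ultimately show ?thesis by blast
  next
    case False
    define x y z where xyz: "x = a * l + m" "y = l + m" "z = - (p * x + q * y) / r"
    have "p * x + q * y + r * z = 0"
      using False by (simp add: xyz)
    note v = vanish[OF this]
    have 1: "l * (x - a * y) + m * (x - y) = 0"
      by (simp add: xyz algebra_simps)
    have "l * (x - a * y) * (x^2 + y^2) + m * (x - y) * (x^2 - x * y + y^2) =
        z^2 * (l * (x - a * y) + m * (x - y))"
      using v by (simp add: algebra_simps)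
    moreover have "(x, y) \<noteq> (0, 0)"
    proof
      assume "(x, y) = (0, 0)"
      then have "m = - l" "(a - 1) * l = 0"
        by (auto simp: xyz algebra_simps add_eq_0_iff)
      then show False
        using assms(2,3) by simp
    qed
    ultimately show ?thesis
      using 1 by auto
  qed
  then obtain x y where xy: "(x, y) \<noteq> (0, 0)" and lin: "l * (x - a * y) + m * (x - y) = 0"
    and cub: "l * (x - a * y) * (x^2 + y^2) + m * (x - y) * (x^2 - x * y + y^2) = 0"
    by blast
  \<comment> \<open>The left-hand side is \<open>f\<^sub>3 - (x\<^sup>2 - x y + y\<^sup>2) f\<^sub>1\<close>.\<close>
  have "l * (x - a * y) * (x * y) = 0"
    using lin cub by algebra
  then consider "l = 0" | "x = a * y" | "x = 0" | "y = 0"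
    by auto
  then show ?thesis
  proof cases
    case 2
    then have "m * ((a - 1) * y) = 0"
      using lin by (simp add: algebra_simps)
    then show ?thesis
      using 2 xy assms(2) by auto
  next
    case 3
    then have "(a * l + m) * y = 0"
      using lin by (simp add: algebra_simps) algebra
    then show ?thesis
      using 3 xy by auto
  next
    case 4
    then have "(l + m) * x = 0"
      using lin by (simp add: algebra_simps)
    then show ?thesis
      using 4 xy by auto
  qed simp
qed

theorem theorem4p1:
  fixes a :: complex
  assumes "a \<noteq> 0" and "a \<noteq> 1"
  defines "C1 \<equiv> (X - const a * Y) * (X^2 + Y^2 - Z^2)"
    and "C2 \<equiv> (X - Y) * (X^2 - X * Y + Y^2 - Z^2)"
    and "C3 \<equiv> Y * (const (2 - a) * X^2 - X * Y + const (1 - a) * Y^2 + const (a - 1) * Z^2)"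
    and "C4 \<equiv> X * (const (1 - a) * X^2 + const a * X * Y + const (1 - 2 * a) * Y^2 + const (a - 1) * Z^2)"
  shows "{C \<in> pencil C1 C2. conic_line_curve C} = {curve C1, curve C2, curve C3, curve C4} \<and>
         card {C \<in> pencil C1 C2. conic_line_curve C} = 4"
proof -
  let ?P = "\<lambda>l m. const l * C1 + const m * C2"
  have C3: "C3 = ?P 1 (- 1)" and C4: "C4 = ?P 1 (- a)"
    by (simp_all add: C1_def C2_def C3_def C4_def algebra_simps power2_eq_square)
  have C1: "C1 = ?P 1 0" and C2: "C2 = ?P 0 1"
    by simp_all
  have val: "eval x y z (?P l m) =
      l * ((x - a * y) * (x^2 + y^2 - z^2)) + m * ((x - y) * (x^2 - x * y + y^2 - z^2))" for x y z l m
    by (simp add: C1_def C2_def eval_simps)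
  \<comment> \<open>Proportional members have proportional parameters: compare the coefficients of \<open>x\<^sup>3\<close> and \<open>y\<^sup>3\<close>,
      which are \<open>l + m\<close> and \<open>- (a l + m)\<close>, and use \<open>a \<noteq> 1\<close>.\<close>
  have inj: "l = c * l' \<and> m = c * m'" if "?P l m = const c * ?P l' m'" for l m l' m' c
  proof -
    have *: "eval x y z (?P l m) = c * eval x y z (?P l' m')" for x y z
      unfolding that by (simp only: eval_simps)
    have "l + m = c * (l' + m')"
      using *[of 1 0 0] unfolding val by (simp add: algebra_simps)
    moreover have "a * l + m = c * (a * l' + m')"
      using *[of 0 1 0] unfolding val by simp algebra
    ultimately have "(a - 1) * (l - c * l') = 0" and m: "m = c * (l' + m') - l"
      by algebra+
    then have "l = c * l'"
      using assms(2) by simp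
    with m show ?thesis
      by (simp add: algebra_simps)
  qed
  have lines: "form_of_degree 1 (X - const a * Y)" "form_of_degree 1 (X - Y)" "form_of_degree 1 X"
    by (rule form_of_degreeI[of _ _ 1 0 0]; simp add: grade_simps eval_simps mult_monom diff_monom)+
  have line_Y: "form_of_degree 1 Y"
    by (rule form_of_degreeI[of _ _ 0 1 0]) (simp_all add: grade_simps eval_simps)
  \<comment> \<open>At \<open>(0, 0, 1)\<close> the value is the coefficient of \<open>z\<^sup>2\<close>, which is nonzero in all four conics.\<close>
  have conics: "form_of_degree 2 (X^2 + Y^2 - Z^2)" "form_of_degree 2 (X^2 - X * Y + Y^2 - Z^2)"
     "form_of_degree 2 (const (2 - a) * X^2 - X * Y + const (1 - a) * Y^2 + const (a - 1) * Z^2)"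
     "form_of_degree 2 (const (1 - a) * X^2 + const a * X * Y + const (1 - 2 * a) * Y^2 + const (a - 1) * Z^2)"
    by (rule form_of_degreeI[of _ _ 0 0 1]; use assms(2) in \<open>simp add: grade_simps eval_simps mult_monom
        monom_power add_monom diff_monom numeral_2_eq_2 del: const_simps\<close>)+
  have conic_line: "\<forall>C\<in>{curve C1, curve C2, curve C3, curve C4}. conic_line_curve C"
    unfolding C1_def C2_def C3_def C4_def using lines line_Y conics
    by (blast intro: conic_line_curve_line_conic)
  have cubic: "form_of_degree 3 (?P l m)" if "(l, m) \<noteq> (0, 0)" for l m
  proof -
    have "?P l m \<noteq> 0"
      using inj[of l m 0 0 0] that by auto
    moreover have "grade (?P l m) = monom (?P l m) 3"
      by (simp add: C1_def C2_def grade_simps mult_monom monom_power add_monom diff_monom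
         numeral_2_eq_2 numeral_3_eq_3 del: const_simps)
    ultimately show ?thesis
      by (simp add: form_of_degree_iff)
  qed
  have members: "{C \<in> pencil C1 C2. conic_line_curve C} = {curve C1, curve C2, curve C3, curve C4}"
  proof (intro equalityI subsetI)
    fix C assume "C \<in> {C \<in> pencil C1 C2. conic_line_curve C}"
    then obtain l m where lm: "(l, m) \<noteq> (0, 0)" "C = curve (?P l m)" "conic_line_curve C"
      by (auto simp: pencil_def)
    obtain L where "form_of_degree 1 L" "L dvd ?P l m"
      using conic_line_curve_odd_has_line[OF lm(3)[unfolded lm(2)] cubic[OF lm(1)]] by auto
    then have "l = 0 \<or> m = 0 \<or> l + m = 0 \<or> a * l + m = 0"
      using line_in_pencil_member[OF assms(2) lm(1)] unfolding C1_def C2_def by blast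
    then consider "l = 0" "m \<noteq> 0" | "m = 0" "l \<noteq> 0" | "m = l * - 1" "l \<noteq> 0" | "m = l * - a" "l \<noteq> 0"
      using lm(1) by (auto simp: add_eq_0_iff mult.commute)
    then show "C \<in> {curve C1, curve C2, curve C3, curve C4}"
    proof cases
      case 1
      then have "C = curve (const m * C2)"
        by (simp add: lm(2))
      then show ?thesis using 1 by (simp add: curve_scale)
    next
      case 2
      then have "C = curve (const l * C1)"
        by (simp add: lm(2))
      then show ?thesis using 2 by (simp add: curve_scale)
    next
      case 3
      then have "C = curve (const l * C3)"
        by (simp add: lm(2) C3 algebra_simps)
      then show ?thesis using 3 by (simp add: curve_scale)
    next
      case 4
      then have "C = curve (const l * C4)"
        by (simp add: lm(2) C4 algebra_simps)
      then show ?thesis using 4 by (simp add: curve_scale)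
    qed
  next
    fix C assume C: "C \<in> {curve C1, curve C2, curve C3, curve C4}"
    have in_pencil: "curve (?P l m) \<in> pencil C1 C2" if "(l, m) \<noteq> (0, 0)" for l m
      unfolding pencil_def using that by blast
    have "curve C1 \<in> pencil C1 C2"
      using in_pencil[of 1 0] by simp
    moreover have "curve C2 \<in> pencil C1 C2"
      using in_pencil[of 0 1] by simp
    moreover have "curve C3 \<in> pencil C1 C2"
      using in_pencil[of 1 "- 1"] by (simp add: C3)
    moreover have "curve C4 \<in> pencil C1 C2"
      using in_pencil[of 1 "- a"] by (simp add: C4)
    ultimately show "C \<in> {C \<in> pencil C1 C2. conic_line_curve C}"
      using C conic_line by auto
  qed
  have distinct: "curve (?P l m) \<noteq> curve (?P l' m')" if "l * m' \<noteq> l' * m" for l m l' m'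
  proof
    assume "curve (?P l m) = curve (?P l' m')"
    then obtain c where "?P l m = const c * ?P l' m'"
      by (rule curve_eqE)
    from inj[OF this] show False
      using that by (simp add: mult.left_commute mult.commute)
  qed
  have "curve C1 \<noteq> curve C2"
    using distinct[of 1 1 0 0] by (simp add: C3 C4)
  moreover have "curve C1 \<noteq> curve C3"
    using distinct[of 1 "- 1" 1 0] by (simp add: C3 C4)
  moreover have "curve C1 \<noteq> curve C4"
    using distinct[of 1 "- a" 1 0] assms(1) by (simp add: C3 C4)
  moreover have "curve C2 \<noteq> curve C3"
    using distinct[of 0 "- 1" 1 1] by (simp add: C3 C4)
  moreover have "curve C2 \<noteq> curve C4"
    using distinct[of 0 "- a" 1 1] by (simp add: C3 C4)
  moreover have "curve C3 \<noteq> curve C4"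
    using distinct[of 1 "- a" 1 "- 1"] assms(2) by (simp add: C3 C4)
  ultimately have "card {curve C1, curve C2, curve C3, curve C4} = 4"
    by simp
  then show ?thesis
    unfolding members by simp
qed

end
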